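(* Let $n$ be an integer with $1\le n\le\left\lfloor\frac{R\mu}{C}\right\rfloor$. Then the revenue rate function $r_n$ is concave on $\mathbb R_+=[0,\infty)$.
   Context: $R,C,\mu>0$ are fixed real constants. For an integer $n\ge0$, the revenue rate function $r_n:[0,\infty)\to\mathbb R$ is $$r_n(\rho)=(R\mu-Cn)\,\frac{\rho(1-\rho^n)}{1-\rho^{n+1}}\ (\rho\ne1),\qquad r_n(1)=(R\mu-Cn)\,\frac{n}{n+1}.$$ *)

theory Defs
  imports "HOL-Analysis.Analysis"
begin

(* The argument \<rho> is meant to range over {0..}; values at negative \<rho> are irrelevant. *)
definition revenue_rate :: "real \<Rightarrow> real \<Rightarrow> real \<Rightarrow> nat \<Rightarrow> real \<Rightarrow> real" where
  "revenue_rate R C \<mu> n \<rho> =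
     (if \<rho> = 1 then (R * \<mu> - C * real n) * (real n / (real n + 1))
      else (R * \<mu> - C * real n) * (\<rho> * (1 - \<rho> ^ n) / (1 - \<rho> ^ (n + 1))))"

end

theory Submission
  imports Defs
begin

text \<open>With A(x) = 1 + x + ... + x^n the revenue rate is K (1 - 1/A), where K \<ge> 0 is
  the constant factor, so it suffices that 1/A is convex, i.e. that A A'' \<le> 2 A'^2. This follows
  by induction on n along A(x) \<mapsto> 1 + x A(x), once the induction hypothesis is strengthened by
  lower-order inequalities that absorb the cross terms.\<close>

text \<open>Being a polynomial, this has no singularity at 1, unlike the quotient
  \<open>(1 - x ^ (n + 1)) / (1 - x)\<close> that it replaces.\<close>

definition geometric_sum :: "nat \<Rightarrow> real \<Rightarrow> real" where
  "geometric_sum n x = (\<Sum>i\<le>n. x ^ i)"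

lemma geometric_sum_0 [simp]: "geometric_sum 0 x = 1"
  by (simp add: geometric_sum_def)

lemma geometric_sum_Suc: "geometric_sum (Suc n) x = 1 + x * geometric_sum n x"
  unfolding geometric_sum_def sum.atMost_Suc_shift
  by (simp add: sum_distrib_left)

lemma geometric_sum_ge_1: "x \<ge> 0 \<Longrightarrow> geometric_sum n x \<ge> 1"
  by (induction n) (simp_all add: geometric_sum_Suc)

lemma geometric_sum_le_Suc:
  "x \<ge> 0 \<Longrightarrow> geometric_sum n x \<le> 1 + x * geometric_sum n x"
  unfolding geometric_sum_Suc [symmetric] by (simp add: geometric_sum_def)

text \<open>For \<open>B = 1 + x * A\<close> the product rule gives \<open>B' = A + x * A'\<close>
  and \<open>B'' = 2 * A' + x * A''\<close>, so the derivatives are built by recursion rather than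
  as explicit sums. They exist on the whole line; only the inequality needs a sign of
  \<open>x\<close>.\<close>

lemma geometric_sum_derivatives:
  obtains A' A'' where
    "\<And>x. (geometric_sum n has_real_derivative A' x) (at x)"
    "\<And>x. (A' has_real_derivative A'' x) (at x)"
    "\<And>x. x \<ge> 0 \<Longrightarrow> geometric_sum n x * A'' x \<le> 2 * (A' x)\<^sup>2"
proof -
  \<comment> \<open>In terms of the next sum \<open>B\<close>, the two additional inequalities read
    \<open>A' \<le> B'\<close> and \<open>B'' \<le> 2 * A * B'\<close>. The second bounds the cross
    term in the main inequality for \<open>B\<close>; the first lets the second be
    inherited.\<close>
  have "\<exists>A' A''. \<forall>x.
      (geometric_sum n has_real_derivative A' x) (at x) \<and>
      (A' has_real_derivative A'' x) (at x) \<and>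
      (x \<ge> 0 \<longrightarrow> A' x \<le> geometric_sum n x + x * A' x \<and>
        2 * A' x + x * A'' x \<le> 2 * geometric_sum n x * (geometric_sum n x + x * A' x) \<and>
        geometric_sum n x * A'' x \<le> 2 * (A' x)\<^sup>2)"
  proof (induction n)
    case 0
    have "geometric_sum 0 = (\<lambda>x. 1)"
      by auto
    then show ?case
      by (intro exI [of _ "\<lambda>x. 0"]) simp
  next
    case (Suc n)
    let ?A = "geometric_sum n"
    have Suc_fun: "geometric_sum (Suc n) = (\<lambda>x. 1 + x * ?A x)"
      by (simp add: fun_eq_iff geometric_sum_Suc)
    from Suc.IH obtain A' A'' where
      A': "\<And>x. (?A has_real_derivative A' x) (at x)" and
      A'': "\<And>x. (A' has_real_derivative A'' x) (at x)" and
      le1: "\<And>x. x \<ge> 0 \<Longrightarrow> A' x \<le> ?A x + x * A' x" and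
      le2: "\<And>x. x \<ge> 0 \<Longrightarrow> 2 * A' x + x * A'' x \<le> 2 * ?A x * (?A x + x * A' x)" and
      le3: "\<And>x. x \<ge> 0 \<Longrightarrow> ?A x * A'' x \<le> 2 * (A' x)\<^sup>2"
      by blast
    define B' where "B' x = ?A x + x * A' x" for x
    define B'' where "B'' x = 2 * A' x + x * A'' x" for x
    have "(geometric_sum (Suc n) has_real_derivative B' x) (at x)" for x
      unfolding Suc_fun B'_def by (auto intro!: derivative_eq_intros A')
    moreover have "(B' has_real_derivative B'' x) (at x)" for x
      unfolding B'_def B''_def by (auto intro!: derivative_eq_intros A' A'')
    moreover have
      "B' x \<le> geometric_sum (Suc n) x + x * B' x"
      "2 * B' x + x * B'' x
        \<le> 2 * geometric_sum (Suc n) x * (geometric_sum (Suc n) x + x * B' x)"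
      "geometric_sum (Suc n) x * B'' x \<le> 2 * (B' x)\<^sup>2"
      if x: "x \<ge> 0" for x
    proof -
      define B where "B = geometric_sum (Suc n) x"
      have B: "B = 1 + x * ?A x"
        by (simp add: B_def geometric_sum_Suc)
      have "B \<ge> 1"
        using geometric_sum_ge_1 [OF x] by (simp add: B_def)
      \<comment> \<open>Add \<open>A \<le> B\<close>, where \<open>B\<close> has one more
        nonnegative term, to \<open>x\<close> times the induction hypothesis
        \<open>A' \<le> B'\<close>.\<close>
      show 1: "B' x \<le> geometric_sum (Suc n) x + x * B' x"
        using geometric_sum_le_Suc [OF x, of n] mult_left_mono [OF le1 [OF x] x]
        by (simp add: B'_def geometric_sum_Suc)
      have B''_le: "B'' x \<le> 2 * ?A x * B' x"
        using le2 [OF x] by (simp add: B'_def B''_def)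
      \<comment> \<open>After the bound on \<open>B''\<close>, the factor
        \<open>1 + x * A = B\<close> reappears and leaves \<open>2 * B * B'\<close>; inequality
        \<open>1\<close> then enlarges \<open>B'\<close> to \<open>B + x * B'\<close>.\<close>
      have "2 * B' x + x * B'' x \<le> 2 * B' x + x * (2 * ?A x * B' x)"
        using mult_left_mono [OF B''_le x] by simp
      also have "\<dots> = 2 * B * B' x"
        by (simp add: B algebra_simps)
      also have "\<dots> \<le> 2 * B * (B + x * B' x)"
        using 1 \<open>B \<ge> 1\<close> by (intro mult_left_mono) (auto simp: B_def)
      finally show "2 * B' x + x * B'' x
          \<le> 2 * geometric_sum (Suc n) x * (geometric_sum (Suc n) x + x * B' x)"
        by (simp add: B_def)
      \<comment> \<open>Expand \<open>(1 + x * A) * B''\<close>, but keep the summand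
        \<open>B''\<close> whole so that \<open>B''_le\<close> applies to it. The three bounded
        summands then add up to exactly \<open>2 * (A + x * A')\<^sup>2\<close>.\<close>
      have "B * B'' x = B'' x + 2 * x * ?A x * A' x + x\<^sup>2 * (?A x * A'' x)"
        by (simp add: B B''_def algebra_simps power2_eq_square)
      also have "\<dots> \<le> 2 * ?A x * B' x + 2 * x * ?A x * A' x + x\<^sup>2 * (2 * (A' x)\<^sup>2)"
        by (intro add_mono mult_left_mono B''_le le3 x order_refl) auto
      also have "\<dots> = 2 * (B' x)\<^sup>2"
        by (simp add: B'_def algebra_simps power2_eq_square)
      finally show "geometric_sum (Suc n) x * B'' x \<le> 2 * (B' x)\<^sup>2"
        by (simp add: B_def)
    qed
    ultimately show ?case
      by blast
  qed
  then show ?thesis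
    using that by blast
qed

text \<open>Second derivative test: the numerator of \<open>(1/A)''\<close> over
  \<open>A ^ 3\<close> is \<open>2 * A'\<^sup>2 - A * A''\<close>. Two-sided derivatives are
  available even at the endpoint 0, since \<open>A\<close> is differentiable on all of the reals and
  positive there.\<close>

lemma convex_on_inverse_geometric_sum:
  "convex_on {0..} (\<lambda>x. inverse (geometric_sum n x))"
proof -
  let ?A = "geometric_sum n"
  obtain A' A'' where
    A': "\<And>x. (?A has_real_derivative A' x) (at x)" and
    A'': "\<And>x. (A' has_real_derivative A'' x) (at x)" and
    le: "\<And>x. x \<ge> 0 \<Longrightarrow> ?A x * A'' x \<le> 2 * (A' x)\<^sup>2"
    using geometric_sum_derivatives [of n] by blast
  have pos: "?A x > 0" if "x \<ge> 0" for x
    using geometric_sum_ge_1 [OF that, of n] by linarith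
  show ?thesis
  proof (rule f''_ge0_imp_convex)
    show "convex {0::real..}"
      by simp
  next
    fix x :: real
    assume "x \<in> {0..}"
    then have "?A x > 0"
      using pos by simp
    then show "((\<lambda>x. inverse (?A x)) has_real_derivative - A' x / (?A x)\<^sup>2) (at x)"
      by (auto intro!: derivative_eq_intros A' simp: field_simps power2_eq_square)
    show "((\<lambda>x. - A' x / (?A x)\<^sup>2) has_real_derivative
        (2 * (A' x)\<^sup>2 - ?A x * A'' x) / (?A x) ^ 3) (at x)"
      using \<open>?A x > 0\<close>
      by (auto intro!: derivative_eq_intros A' A''
          simp: field_simps power2_eq_square power3_eq_cube)
    show "(2 * (A' x)\<^sup>2 - ?A x * A'' x) / (?A x) ^ 3 \<ge> 0"
      using \<open>?A x > 0\<close> le [of x] \<open>x \<in> {0..}\<close> by simp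
  qed
qed

text \<open>Off 1, \<open>(1 - \<rho>) * A = 1 - \<rho> ^ (n + 1)\<close> turns
  \<open>1 - 1/A\<close> into the defining quotient; at 1, \<open>A = n + 1\<close> yields
  \<open>n / (n + 1)\<close>. Both cases of the definition thus merge into one formula.\<close>

lemma revenue_rate_eq:
  assumes "\<rho> \<ge> 0"
  shows "revenue_rate R C \<mu> n \<rho> = (R * \<mu> - C * real n) * (1 - inverse (geometric_sum n \<rho>))"
proof (cases "\<rho> = 1")
  case True
  then show ?thesis
    by (simp add: revenue_rate_def geometric_sum_def field_simps)
next
  case False
  have A: "(1 - \<rho>) * geometric_sum n \<rho> = 1 - \<rho> ^ (n + 1)"
    using sum_gp_basic [of \<rho> n] by (simp add: geometric_sum_def)
  have "geometric_sum n \<rho> \<noteq> 0"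
    using geometric_sum_ge_1 [OF assms, of n] by linarith
  with False A have "1 - \<rho> ^ (n + 1) \<noteq> 0"
    by (metis mult_eq_0_iff right_minus_eq)
  moreover have "inverse (geometric_sum n \<rho>) = (1 - \<rho>) / (1 - \<rho> ^ (n + 1))"
    unfolding A [symmetric] using False by (simp add: divide_inverse)
  ultimately have "\<rho> * (1 - \<rho> ^ n) / (1 - \<rho> ^ (n + 1)) = 1 - inverse (geometric_sum n \<rho>)"
    by (simp add: field_simps)
  with False show ?thesis
    by (simp add: revenue_rate_def)
qed

theorem lemma3p7:
  fixes R C \<mu> :: real and n :: nat
  assumes "R > 0" and "C > 0" and "\<mu> > 0"
    and "1 \<le> n" and "int n \<le> \<lfloor>R * \<mu> / C\<rfloor>"
  shows "concave_on {0..} (revenue_rate R C \<mu> n)"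
proof -
  define K where "K = R * \<mu> - C * real n"
  \<comment> \<open>The floor bound on \<open>n\<close> makes the factor \<open>K\<close>
    nonnegative, so scaling by it preserves convexity.\<close>
  have "real n \<le> R * \<mu> / C"
    using assms(5) by (simp add: le_floor_iff)
  then have "K \<ge> 0"
    using \<open>C > 0\<close> by (simp add: K_def field_simps)
  then have "convex_on {0..} (\<lambda>\<rho>. - K + K * inverse (geometric_sum n \<rho>))"
    by (intro convex_on_add convex_on_cmul convex_on_inverse_geometric_sum)
      (simp_all add: convex_on_const)
  moreover have "- revenue_rate R C \<mu> n \<rho> = - K + K * inverse (geometric_sum n \<rho>)"
    if "\<rho> \<in> {0..}" for \<rho>
    using that by (simp add: revenue_rate_eq K_def algebra_simps)
  \<comment> \<open>The rewriting of the negated revenue rate is valid only on the half-line, which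
    contains the two points and their convex combination, the only arguments in the convexity
    inequality.\<close>
  ultimately show ?thesis
    unfolding concave_on_def convex_on_def by (simp del: minus_add_distrib)
qed

end
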